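(* Let $G$ be a compactly presented locally compact group with compact symmetric generating set $S$, let $\delta$ be its Dehn function, and let $\mathcal{F}$ be an efficient set of words in $S$. Suppose that for some real number $\zeta>1$ the following holds: for every integer $k\ge 1$ there is a constant $a_k$ such that $\delta_{\mathcal{F}[k]}(n)\le a_k n^\zeta$ for all $n$. Then there exists a constant $C'$ such that $\delta(n)\le C'n^\zeta$ for all $n$.
   Context: Compact presentability means that there is an integer $\ell$ such that the abstract group $G$ has a presentation with generating set $S$ and relators of length $\le\ell$; fix such $(S,\ell)$. A relation (null-homotopic word) is a word in the letters of $S$ representing the trivial element of $G$; its area is the least $m$ such that it is, in the free group on $S$, a product of $\le m$ conjugates of relations of length $\le\ell$. The Dehn function is $\delta(n)=\sup\{\mathrm{area}(w): w\text{ a relation of length}\le n\}$. For words $w,w'$ in $S$, $w\equiv w'$ means they represent the same element of $G$, and $|w|_S$ is the length of the word $w$. For a set $\mathcal{F}$ of words in $S$, $\mathcal{F}[k]$ is the set of words obtained as the concatenation of $\le k$ words of $\mathcal{F}$. The restricted Dehn function $\delta_{\mathcal{F}}(n)$ is the supremum of the areas of the null-homotopic words of length $\le n$ belonging to $\mathcal{F}$ (with $\sup\emptyset=0$). The set $\mathcal{F}$ is efficient if there is a constant $C$ such that for every word $w$ in $S$ there exists $w'\in\mathcal{F}$ with $w'\equiv w$ and $|w'|_S\le C|w|_S$.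
   Formalization: The formal theorem additionally assumes that δ(n) is finite for every n; for a badly chosen pair (S,ℓ) the Dehn function can be infinite and the literal claim fails, while finiteness is implied by the conclusion. *)

theory Defs
  imports "HOL-Analysis.Analysis" "HOL-Algebra.Generated_Groups"
begin

text \<open>Locally compact groups are Hausdorff by convention.\<close>

definition locally_compact_group :: "('a, 'b) monoid_scheme \<Rightarrow> 'a topology \<Rightarrow> bool" where
  "locally_compact_group G T \<longleftrightarrow>
     group G \<and> topspace T = carrier G \<and>
     continuous_map (prod_topology T T) T (\<lambda>(x, y). x \<otimes>\<^bsub>G\<^esub> y) \<and>
     continuous_map T T (\<lambda>x. inv\<^bsub>G\<^esub> x) \<and>
     Hausdorff_space T \<and> locally_compact_space T"

definition compact_symmetric_generating_set ::
    "('a, 'b) monoid_scheme \<Rightarrow> 'a topology \<Rightarrow> 'a set \<Rightarrow> bool" where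
  "compact_symmetric_generating_set G T S \<longleftrightarrow>
     compactin T S \<and> (\<forall>s\<in>S. inv\<^bsub>G\<^esub> s \<in> S) \<and> generate G S = carrier G"


section \<open>The free group on a set\<close>

text \<open>
  The pair \<open>(True, s)\<close> stands for the free generator \<open>s\<close> and \<open>(False, s)\<close> for its formal inverse.
  The free group on \<open>S\<close> is \<open>lists (UNIV \<times> S)\<close> modulo \<open>free_eq\<close>, with concatenation as product.
  The intermediate words of \<open>free_eq\<close> may use letters outside \<open>S\<close>; this does not change the
  relation on \<open>lists (UNIV \<times> S)\<close>, because the free group on \<open>S\<close> embeds in the one on the whole type.
\<close>

type_synonym 'a signed_word = "(bool \<times> 'a) list"

inductive free_eq :: "'a signed_word \<Rightarrow> 'a signed_word \<Rightarrow> bool" where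
  cancel: "free_eq (u @ [(b, x), (\<not> b, x)] @ v) (u @ v)"
| refl: "free_eq u u"
| sym: "free_eq u v \<Longrightarrow> free_eq v u"
| trans: "free_eq u v \<Longrightarrow> free_eq v w \<Longrightarrow> free_eq u w"

definition formal_inv :: "'a signed_word \<Rightarrow> 'a signed_word" where
  "formal_inv u = rev (map (\<lambda>(b, x). (\<not> b, x)) u)"

text \<open>
  \<open>conj_product S R m u\<close>: in the free group on \<open>S\<close>, the element \<open>u\<close> is a product of at most \<open>m\<close>
  conjugates of elements of \<open>R\<close> and their inverses.
\<close>

definition conj_product :: "'a set \<Rightarrow> 'a signed_word set \<Rightarrow> nat \<Rightarrow> 'a signed_word \<Rightarrow> bool" where
  "conj_product S R m u \<longleftrightarrow>
     (\<exists>cs. length cs \<le> m \<and>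
        (\<forall>(g, r)\<in>set cs. g \<in> lists (UNIV \<times> S) \<and> r \<in> R \<union> formal_inv ` R) \<and>
        free_eq u (concat (map (\<lambda>(g, r). g @ r @ formal_inv g) cs)))"

definition signed_value :: "('a, 'b) monoid_scheme \<Rightarrow> 'a signed_word \<Rightarrow> 'a" where
  "signed_value G u =
     foldr (\<lambda>(b, x) y. (if b then x else inv\<^bsub>G\<^esub> x) \<otimes>\<^bsub>G\<^esub> y) u \<one>\<^bsub>G\<^esub>"

text \<open>
  \<open>G\<close>, as an abstract group, has a presentation with generating set \<open>S\<close> and relators of length at
  most \<open>l\<close>: the kernel of the map from the free group on \<open>S\<close> to \<open>G\<close> is the normal closure of a set
  of elements of length at most \<open>l\<close>.
\<close>

definition presented_in_length :: "('a, 'b) monoid_scheme \<Rightarrow> 'a set \<Rightarrow> nat \<Rightarrow> bool" where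
  "presented_in_length G S l \<longleftrightarrow>
     generate G S = carrier G \<and>
     (\<exists>R \<subseteq> {r \<in> lists (UNIV \<times> S). length r \<le> l}.
        \<forall>u \<in> lists (UNIV \<times> S). signed_value G u = \<one>\<^bsub>G\<^esub> \<longleftrightarrow> (\<exists>m. conj_product S R m u))"


section \<open>Words, areas and Dehn functions\<close>

text \<open>
  As \<open>S\<close> is symmetric, words in \<open>S\<close> are lists of elements of \<open>S\<close>. The letter \<open>inv s \<in> S\<close> and the
  formal inverse of \<open>s\<close> are different elements of the free group on \<open>S\<close>.
\<close>

definition word_value :: "('a, 'b) monoid_scheme \<Rightarrow> 'a list \<Rightarrow> 'a" where
  "word_value G w = foldr (\<lambda>x y. x \<otimes>\<^bsub>G\<^esub> y) w \<one>\<^bsub>G\<^esub>"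

definition relations :: "('a, 'b) monoid_scheme \<Rightarrow> 'a set \<Rightarrow> 'a list set" where
  "relations G S = {w \<in> lists S. word_value G w = \<one>\<^bsub>G\<^esub>}"

definition free_word :: "'a list \<Rightarrow> 'a signed_word" where
  "free_word w = map (Pair True) w"

text \<open>The area is \<open>\<infinity>\<close> if no product decomposition exists.\<close>

definition area :: "('a, 'b) monoid_scheme \<Rightarrow> 'a set \<Rightarrow> nat \<Rightarrow> 'a list \<Rightarrow> enat" where
  "area G S l w =
     Inf {enat m | m. conj_product S (free_word ` {r \<in> relations G S. length r \<le> l}) m (free_word w)}"

definition restricted_dehn ::
    "('a, 'b) monoid_scheme \<Rightarrow> 'a set \<Rightarrow> nat \<Rightarrow> 'a list set \<Rightarrow> nat \<Rightarrow> enat" where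
  "restricted_dehn G S l F n = Sup {area G S l w | w. w \<in> F \<inter> relations G S \<and> length w \<le> n}"

text \<open>
  Finiteness of \<open>dehn G S l n\<close> is not automatic for an infinite compact \<open>S\<close>: a presentation with
  relators of length at most \<open>l\<close> makes every single area finite, but if \<open>l\<close> is too small for \<open>S\<close>
  the areas of the relations of a fixed length can be unbounded.
\<close>

definition dehn :: "('a, 'b) monoid_scheme \<Rightarrow> 'a set \<Rightarrow> nat \<Rightarrow> nat \<Rightarrow> enat" where
  "dehn G S l n = Sup {area G S l w | w. w \<in> relations G S \<and> length w \<le> n}"

definition concat_upto :: "'a list set \<Rightarrow> nat \<Rightarrow> 'a list set" where
  "concat_upto F k = {concat ws | ws. ws \<in> lists F \<and> length ws \<le> k}"

definition efficient :: "('a, 'b) monoid_scheme \<Rightarrow> 'a set \<Rightarrow> 'a list set \<Rightarrow> bool" where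
  "efficient G S F \<longleftrightarrow>
     F \<subseteq> lists S \<and>
     (\<exists>C::real. \<forall>w \<in> lists S. \<exists>w' \<in> F.
        word_value G w' = word_value G w \<and> real (length w') \<le> C * real (length w))"

end

theory Submission
  imports Defs
begin

text \<open>
  Gromov's trick. Cut a relation of length \<open>n\<close> into \<open>k\<close> pieces of length about \<open>n / k\<close> and
  replace each piece by an equivalent word of \<open>F\<close>, at most \<open>C\<close> times longer. This leaves one
  relation in \<open>F[k]\<close> of length at most \<open>2 C n\<close> and \<open>k\<close> relations of length at most
  \<open>2 (1 + C) n / k\<close>; a further area linear in \<open>n\<close> trades formal inverses for inverse letters. So
  \<open>\<delta>(n) \<le> k \<delta>(2 (1 + C) n / k) + A n\<^sup>\<zeta>\<close>. As \<open>\<zeta> > 1\<close>, one can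
  choose \<open>k\<close> with \<open>k (2 (1 + C) / k)\<^sup>\<zeta> \<le> 1/2\<close>, and the bound follows by induction on \<open>n\<close>.
\<close>

section \<open>Products of conjugates\<close>

lemma free_eq_append_left: "free_eq u v \<Longrightarrow> free_eq (p @ u) (p @ v)"
proof (induction rule: free_eq.induct)
  case (cancel u b x v)
  show ?case using free_eq.cancel[of "p @ u" b x v] by simp
qed (auto intro: free_eq.intros)

lemma free_eq_append_right: "free_eq u v \<Longrightarrow> free_eq (u @ p) (v @ p)"
proof (induction rule: free_eq.induct)
  case (cancel u b x v)
  show ?case using free_eq.cancel[of u b x "v @ p"] by simp
qed (auto intro: free_eq.intros)

lemma free_eq_append: "free_eq u v \<Longrightarrow> free_eq u' v' \<Longrightarrow> free_eq (u @ u') (v @ v')"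
  by (meson free_eq.trans free_eq_append_left free_eq_append_right)

lemma formal_inv_Nil [simp]: "formal_inv [] = []"
  by (simp add: formal_inv_def)

lemma formal_inv_Cons: "formal_inv (a # u) = formal_inv u @ [(\<not> fst a, snd a)]"
  by (simp add: formal_inv_def case_prod_unfold)

lemma formal_inv_append [simp]: "formal_inv (u @ v) = formal_inv v @ formal_inv u"
  by (simp add: formal_inv_def)

lemma formal_inv_formal_inv [simp]: "formal_inv (formal_inv u) = u"
  by (induction u) (auto simp: formal_inv_def)

lemma formal_inv_in_lists [simp]:
  "formal_inv u \<in> lists (UNIV \<times> S) \<longleftrightarrow> u \<in> lists (UNIV \<times> S)"
  by (induction u) (auto simp: formal_inv_Cons)

lemma free_eq_append_formal_inv: "free_eq (u @ formal_inv u) []"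
proof (induction u)
  case (Cons a u)
  have "free_eq ([a] @ (u @ formal_inv u) @ [(\<not> fst a, snd a)]) ([a] @ [] @ [(\<not> fst a, snd a)])"
    by (intro free_eq_append_left free_eq_append_right Cons.IH)
  moreover have "free_eq ([a] @ [] @ [(\<not> fst a, snd a)]) []"
    using free_eq.cancel[of "[]" "fst a" "snd a" "[]"] by simp
  ultimately have "free_eq ([a] @ (u @ formal_inv u) @ [(\<not> fst a, snd a)]) []"
    by (rule free_eq.trans)
  then show ?case by (simp add: formal_inv_Cons)
qed (simp add: free_eq.refl)

lemma free_eq_formal_inv_append: "free_eq (formal_inv u @ u) []"
  using free_eq_append_formal_inv[of "formal_inv u"] by simp

lemma free_eq_formal_inv: "free_eq u v \<Longrightarrow> free_eq (formal_inv u) (formal_inv v)"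
proof (induction rule: free_eq.induct)
  case (cancel u b x v)
  show ?case
    using free_eq.cancel[of "formal_inv v" b x "formal_inv u"] by (simp add: formal_inv_Cons)
qed (auto intro: free_eq.intros)

lemma free_eq_cancel_middle:
  "free_eq (p @ formal_inv u @ u @ q) (p @ q)"
  using free_eq_append_left[OF free_eq_append_right[OF free_eq_formal_inv_append], of p u q] by simp

lemma conj_product_mono: "conj_product S R m u \<Longrightarrow> m \<le> m' \<Longrightarrow> conj_product S R m' u"
  unfolding conj_product_def by (meson order_trans)

lemma conj_product_cong: "conj_product S R m u \<Longrightarrow> free_eq u v \<Longrightarrow> conj_product S R m v"
  unfolding conj_product_def by (meson free_eq.sym free_eq.trans)

lemma conj_product_Nil: "conj_product S R m []"
  unfolding conj_product_def by (rule exI[of _ "[]"]) (simp add: free_eq.refl)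

lemma conj_product_append:
  assumes "conj_product S R m u" "conj_product S R m' v"
  shows "conj_product S R (m + m') (u @ v)"
proof -
  let ?c = "\<lambda>cs. concat (map (\<lambda>(g, r). g @ r @ formal_inv g) cs)"
  let ?ok = "\<lambda>cs. \<forall>(g, r)\<in>set cs. g \<in> lists (UNIV \<times> S) \<and> r \<in> R \<union> formal_inv ` R"
  from assms obtain cs cs' where
    "length cs \<le> m" "?ok cs" "free_eq u (?c cs)"
    "length cs' \<le> m'" "?ok cs'" "free_eq v (?c cs')"
    unfolding conj_product_def by auto
  moreover from this have "free_eq (u @ v) (?c (cs @ cs'))"
    by (simp add: free_eq_append)
  moreover have "?ok (cs @ cs')" using calculation by auto
  ultimately show ?thesis
    unfolding conj_product_def by (intro exI[of _ "cs @ cs'"]) simp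
qed

lemma conj_product_conj:
  assumes "conj_product S R m u" "p \<in> lists (UNIV \<times> S)"
  shows "conj_product S R m (p @ u @ formal_inv p)"
proof -
  let ?c = "\<lambda>cs. concat (map (\<lambda>(g, r). g @ r @ formal_inv g) cs)"
  let ?ok = "\<lambda>cs. \<forall>(g, r)\<in>set cs. g \<in> lists (UNIV \<times> S) \<and> r \<in> R \<union> formal_inv ` R"
  let ?p = "map (\<lambda>(g, r). (p @ g, r))"
  from assms obtain cs where cs: "length cs \<le> m" "?ok cs" "free_eq u (?c cs)"
    unfolding conj_product_def by auto
  have conj: "free_eq (p @ ?c cs @ formal_inv p) (?c (?p cs))" for cs
  proof (induction cs)
    case Nil
    show ?case by (simp add: free_eq_append_formal_inv)
  next
    case (Cons a cs)
    obtain g r where a: "a = (g, r)" by force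
    let ?u = "p @ g @ r @ formal_inv g"
    have "free_eq (?u @ ?c cs @ formal_inv p) (?u @ formal_inv p @ p @ ?c cs @ formal_inv p)"
      by (rule free_eq.sym[OF free_eq_cancel_middle])
    moreover have "free_eq (?u @ formal_inv p @ p @ ?c cs @ formal_inv p)
        (?u @ formal_inv p @ ?c (?p cs))"
      by (intro free_eq_append_left Cons.IH)
    ultimately have "free_eq (?u @ ?c cs @ formal_inv p) (?u @ formal_inv p @ ?c (?p cs))"
      by (rule free_eq.trans)
    then show ?case by (simp add: a)
  qed
  have "free_eq (p @ u @ formal_inv p) (p @ ?c cs @ formal_inv p)"
    by (intro free_eq_append_left free_eq_append_right cs(3))
  from free_eq.trans[OF this conj] have "free_eq (p @ u @ formal_inv p) (?c (?p cs))" .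
  moreover have "?ok (?p cs)" using cs(2) assms(2) by fastforce
  ultimately show ?thesis
    unfolding conj_product_def using cs(1) by (intro exI[of _ "?p cs"]) simp
qed

lemma conj_product_formal_inv:
  assumes "conj_product S R m u"
  shows "conj_product S R m (formal_inv u)"
proof -
  let ?c = "\<lambda>cs. concat (map (\<lambda>(g, r). g @ r @ formal_inv g) cs)"
  let ?ok = "\<lambda>cs. \<forall>(g, r)\<in>set cs. g \<in> lists (UNIV \<times> S) \<and> r \<in> R \<union> formal_inv ` R"
  let ?i = "\<lambda>cs. rev (map (\<lambda>(g, r). (g, formal_inv r)) cs)"
  from assms obtain cs where cs: "length cs \<le> m" "?ok cs" "free_eq u (?c cs)"
    unfolding conj_product_def by auto
  have inv: "formal_inv (?c cs) = ?c (?i cs)" for cs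
    by (induction cs) auto
  from free_eq_formal_inv[OF cs(3)] have "free_eq (formal_inv u) (?c (?i cs))"
    unfolding inv .
  moreover have "?ok (?i cs)" using cs(2) by fastforce
  ultimately show ?thesis
    unfolding conj_product_def using cs(1) by (intro exI[of _ "?i cs"]) simp
qed

definition filling ::
    "'a set \<Rightarrow> 'a signed_word set \<Rightarrow> nat \<Rightarrow> 'a signed_word \<Rightarrow> 'a signed_word \<Rightarrow> bool" where
  "filling S R m u v \<longleftrightarrow> conj_product S R m (u @ formal_inv v)"

lemma filling_Nil_right [simp]: "filling S R m u [] \<longleftrightarrow> conj_product S R m u"
  by (simp add: filling_def)

lemma filling_mono: "filling S R m u v \<Longrightarrow> m \<le> m' \<Longrightarrow> filling S R m' u v"
  unfolding filling_def by (rule conj_product_mono)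

lemma filling_refl: "filling S R m u u"
  unfolding filling_def
  by (rule conj_product_cong[OF conj_product_Nil free_eq.sym[OF free_eq_append_formal_inv]])

lemma filling_sym: "filling S R m u v \<Longrightarrow> filling S R m v u"
  unfolding filling_def using conj_product_formal_inv[of S R m "u @ formal_inv v"] by simp

lemma filling_trans:
  assumes "filling S R m u v" "filling S R m' v w"
  shows "filling S R (m + m') u w"
  using conj_product_append[OF assms[unfolded filling_def]]
    free_eq_cancel_middle[of u v "formal_inv w"]
  unfolding filling_def by (auto intro: conj_product_cong)

lemma filling_append:
  assumes "filling S R m u v" "filling S R m' u' v'" "u \<in> lists (UNIV \<times> S)"
  shows "filling S R (m + m') (u @ u') (v @ v')"
proof -
  have "conj_product S R (m' + m) ((u @ (u' @ formal_inv v') @ formal_inv u) @ u @ formal_inv v)"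
    using assms unfolding filling_def by (intro conj_product_append conj_product_conj)
  then have "conj_product S R (m' + m) ((u @ u' @ formal_inv v') @ formal_inv v)"
    using free_eq_cancel_middle[of "u @ u' @ formal_inv v'" u "formal_inv v"]
    by (auto intro: conj_product_cong)
  then show ?thesis by (simp add: filling_def add.commute)
qed

section \<open>Areas\<close>

definition short_relators :: "('a, 'b) monoid_scheme \<Rightarrow> 'a set \<Rightarrow> nat \<Rightarrow> 'a signed_word set" where
  "short_relators G S l = free_word ` {r \<in> relations G S. length r \<le> l}"

lemma free_word_append [simp]: "free_word (u @ v) = free_word u @ free_word v"
  by (simp add: free_word_def)

lemma free_word_Nil [simp]: "free_word [] = []"
  by (simp add: free_word_def)

lemma free_word_in_lists [simp]: "free_word w \<in> lists (UNIV \<times> S) \<longleftrightarrow> w \<in> lists S"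
  by (induction w) (auto simp: free_word_def)

lemma area_le_iff:
  "area G S l w \<le> enat m \<longleftrightarrow> filling S (short_relators G S l) m (free_word w) []"
proof
  let ?A = "{enat m | m. conj_product S (short_relators G S l) m (free_word w)}"
  assume "area G S l w \<le> enat m"
  also have "enat m < enat (Suc m)" by simp
  finally have "Inf ?A < enat (Suc m)"
    by (simp only: area_def short_relators_def)
  then obtain m' where "conj_product S (short_relators G S l) m' (free_word w)" "m' < Suc m"
    unfolding Inf_less_iff by auto
  then show "filling S (short_relators G S l) m (free_word w) []"
    by (simp add: conj_product_mono)
next
  assume "filling S (short_relators G S l) m (free_word w) []"
  then show "area G S l w \<le> enat m"
    by (auto simp: area_def short_relators_def intro!: Inf_lower)
qed

lemma dehn_le_iff:
  "dehn G S l n \<le> enat m \<longleftrightarrow>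
     (\<forall>w \<in> relations G S. length w \<le> n \<longrightarrow> filling S (short_relators G S l) m (free_word w) [])"
  unfolding dehn_def area_le_iff[symmetric] by (auto simp: Sup_le_iff)

lemma dehn_zero: "dehn G S l 0 = 0"
proof -
  have "dehn G S l 0 \<le> enat 0"
    unfolding dehn_le_iff by (simp add: conj_product_Nil)
  then show ?thesis by (simp add: zero_enat_def[symmetric])
qed

lemma dehn_mono: "n \<le> n' \<Longrightarrow> dehn G S l n \<le> dehn G S l n'"
  unfolding dehn_def by (rule Sup_subset_mono) auto

lemma restricted_dehn_filling:
  assumes "ereal_of_enat (restricted_dehn G S l F n) \<le> ereal b"
    and "w \<in> F" "w \<in> relations G S" "length w \<le> n"
  obtains m where "real m \<le> b" "filling S (short_relators G S l) m (free_word w) []"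
proof -
  have "area G S l w \<le> restricted_dehn G S l F n"
    unfolding restricted_dehn_def using assms by (intro Sup_upper) auto
  then have le: "ereal_of_enat (area G S l w) \<le> ereal b"
    using assms(1) by (meson ereal_of_enat_le_iff order_trans)
  then obtain m where "area G S l w = enat m"
    by (cases "area G S l w") auto
  then show ?thesis
    using le that[of m] area_le_iff[of G S l w m] by simp
qed

context group
begin

lemma word_value_closed: "S \<subseteq> carrier G \<Longrightarrow> w \<in> lists S \<Longrightarrow> word_value G w \<in> carrier G"
  by (induction w) (auto simp: word_value_def)

lemma word_value_append:
  assumes "S \<subseteq> carrier G" "u \<in> lists S" "v \<in> lists S"
  shows "word_value G (u @ v) = word_value G u \<otimes> word_value G v"
  using assms(2)
proof (induction u)
  case Nil
  then show ?case using word_value_closed[OF assms(1,3)] by (simp add: word_value_def)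
next
  case (Cons a u)
  moreover have "a \<in> carrier G" using Cons assms(1) by auto
  moreover have "word_value G u \<in> carrier G" "word_value G v \<in> carrier G"
    using Cons assms by (auto intro: word_value_closed)
  ultimately show ?case by (simp add: word_value_def m_assoc)
qed

definition inverse_word :: "'a list \<Rightarrow> 'a list" where
  "inverse_word w = rev (map (m_inv G) w)"

lemma inverse_word_in_lists:
  "\<forall>s\<in>S. inv s \<in> S \<Longrightarrow> w \<in> lists S \<Longrightarrow> inverse_word w \<in> lists S"
  by (auto simp: inverse_word_def)

lemma word_value_inverse_word:
  assumes "S \<subseteq> carrier G" "\<forall>s\<in>S. inv s \<in> S" "w \<in> lists S"
  shows "word_value G (inverse_word w) = inv (word_value G w)"
  using assms(3)
proof (induction w)
  case Nil
  then show ?case by (simp add: word_value_def inverse_word_def)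
next
  case (Cons a w)
  have [simp]: "a \<in> carrier G" "word_value G w \<in> carrier G"
    using Cons assms(1) by (auto intro: word_value_closed)
  have "word_value G (inverse_word (a # w)) = word_value G (inverse_word w @ [inv a])"
    by (simp add: inverse_word_def)
  also have "\<dots> = inv (word_value G w) \<otimes> inv a"
    using Cons assms inverse_word_in_lists[OF assms(2)]
    by (subst word_value_append[OF assms(1)]) (auto simp: word_value_def[of _ "[_]"])
  also have "\<dots> = inv (a \<otimes> word_value G w)"
    by (simp add: inv_mult_group)
  finally show ?case by (simp add: word_value_def)
qed

lemma filling_inverse_word:
  assumes "S \<subseteq> carrier G" "\<forall>s\<in>S. inv s \<in> S" "dehn G S l 2 \<le> enat D" "w \<in> lists S"
  shows "filling S (short_relators G S l) (D * length w) (free_word (inverse_word w @ w)) []"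
  using assms(4)
proof (induction w)
  case Nil
  then show ?case by (simp add: inverse_word_def conj_product_Nil)
next
  case (Cons a w)
  let ?R = "short_relators G S l"
  have "[inv a, a] \<in> relations G S"
    using Cons assms(1,2) by (auto simp: relations_def word_value_def)
  then have "filling S ?R D (free_word [inv a, a]) []"
    using assms(3)[unfolded dehn_le_iff] by fastforce
  then have "filling S ?R (0 + (D + 0))
      (free_word (inverse_word w) @ free_word [inv a, a] @ free_word w)
      (free_word (inverse_word w) @ [] @ free_word w)"
    using Cons assms(2) inverse_word_in_lists[OF assms(2)]
    by (intro filling_append filling_refl) auto
  moreover have "filling S ?R (D * length w)
      (free_word (inverse_word w) @ [] @ free_word w) []"
    using Cons by simp
  ultimately have "filling S ?R (0 + (D + 0) + D * length w)
      (free_word (inverse_word w) @ free_word [inv a, a] @ free_word w) []"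
    by (rule filling_trans)
  then show ?case by (simp add: inverse_word_def free_word_def)
qed

lemma filling_equivalent_words:
  assumes "S \<subseteq> carrier G" "\<forall>s\<in>S. inv s \<in> S" "dehn G S l 2 \<le> enat D"
    and "dehn G S l (length w + length w') \<le> enat m"
    and "w \<in> lists S" "w' \<in> lists S" "word_value G w' = word_value G w"
  shows "filling S (short_relators G S l) (m + D * length w') (free_word w) (free_word w')"
proof -
  let ?R = "short_relators G S l" and ?i = "inverse_word w'"
  have i: "?i \<in> lists S" using assms inverse_word_in_lists by blast
  have "word_value G (w @ ?i) = \<one>"
    using assms i word_value_closed[OF assms(1)]
    by (simp add: word_value_append[OF assms(1)] word_value_inverse_word)
  then have "w @ ?i \<in> relations G S" "length (w @ ?i) \<le> length w + length w'"
    using assms i by (auto simp: relations_def inverse_word_def)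
  then have "filling S ?R m (free_word (w @ ?i)) []"
    using assms(4) dehn_le_iff by blast
  then have "filling S ?R (m + 0) (free_word (w @ ?i) @ free_word w') ([] @ free_word w')"
    using assms i by (intro filling_append filling_refl) auto
  then have "filling S ?R m (free_word w @ free_word (?i @ w')) (free_word w')"
    by simp
  moreover have "filling S ?R (D * length w') (free_word w) (free_word w @ free_word (?i @ w'))"
  proof -
    have "filling S ?R (D * length w') [] (free_word (?i @ w'))"
      using filling_inverse_word[OF assms(1-3,6)] by (rule filling_sym)
    then have "filling S ?R (0 + D * length w') (free_word w @ [])
        (free_word w @ free_word (?i @ w'))"
      using assms by (intro filling_append filling_refl) auto
    then show ?thesis by simp
  qed
  ultimately show ?thesis
    using filling_trans by (metis add.commute)
qed

lemma word_value_concat_cong: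
  assumes "S \<subseteq> carrier G"
    and "\<And>v. v \<in> set ws \<Longrightarrow> v \<in> lists S \<and> f v \<in> lists S \<and> word_value G (f v) = word_value G v"
  shows "word_value G (concat (map f ws)) = word_value G (concat ws)"
  using assms(2)
proof (induction ws)
  case (Cons v ws)
  have "concat ws \<in> lists S" "concat (map f ws) \<in> lists S"
    using Cons.prems by fastforce+
  with Cons show ?case by (simp add: word_value_append[OF assms(1)])
qed simp

end

lemma filling_concat:
  assumes "\<And>v. v \<in> set ws \<Longrightarrow> v \<in> lists S \<and> filling S R m (free_word v) (free_word (f v))"
  shows "filling S R (length ws * m) (free_word (concat ws)) (free_word (concat (map f ws)))"
  using assms
proof (induction ws)
  case Nil
  show ?case by (simp add: filling_refl)
next
  case (Cons v ws)
  then have "filling S R (m + length ws * m) (free_word v @ free_word (concat ws))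
      (free_word (f v) @ free_word (concat (map f ws)))"
    by (intro filling_append) auto
  then show ?case by simp
qed

lemma concat_pieces:
  assumes "length w \<le> k * m"
  obtains ws where "concat ws = w" "length ws = k" "\<And>v. v \<in> set ws \<Longrightarrow> length v \<le> m"
proof -
  have "\<exists>ws. concat ws = w \<and> length ws = k \<and> (\<forall>v\<in>set ws. length v \<le> m)"
    using assms
  proof (induction k arbitrary: w)
    case (Suc k)
    then have "length (drop m w) \<le> k * m" by simp
    then obtain ws where "concat ws = drop m w" "length ws = k" "\<forall>v\<in>set ws. length v \<le> m"
      using Suc.IH by blast
    then show ?case by (intro exI[of _ "take m w # ws"]) simp
  qed simp
  then show ?thesis using that by blast
qed

section \<open>The recursion\<close>

lemma (in group) dehn_recursion:
  fixes C :: real and a \<zeta> :: real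
  assumes S: "S \<subseteq> carrier G" "\<forall>s\<in>S. inv s \<in> S"
    and fin: "\<And>n. dehn G S l n = enat (f n)"
    and F: "F \<subseteq> lists S" "C \<ge> 0"
      "\<And>w. w \<in> lists S \<Longrightarrow>
         \<exists>w'\<in>F. word_value G w' = word_value G w \<and> real (length w') \<le> C * real (length w)"
    and a: "\<And>n. ereal_of_enat (restricted_dehn G S l (concat_upto F k) n) \<le> ereal (a * real n powr \<zeta>)"
    and "\<zeta> \<ge> 1" "k \<ge> 1" "n \<ge> k"
  shows "\<exists>p. real p \<le> 2 * (1 + C) / real k * real n \<and>
    real (f n) \<le> real k * real (f p)
      + (2 * C * real (f 2) + \<bar>a\<bar> * (2 * C) powr \<zeta>) * real n powr \<zeta>"
proof -
  define q where "q = n div k + 1"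
  define L where "L = nat \<lfloor>C * real q\<rfloor>"
  define p where "p = q + L"
  let ?R = "short_relators G S l"
  let ?b = "real (k * (f p + f 2 * L)) + a * real (k * L) powr \<zeta>"
  have "k * (n div k) \<le> n" by simp
  then have "real k * real (n div k) \<le> real n"
    by (metis of_nat_le_iff of_nat_mult)
  then have kq: "real k * real q \<le> 2 * real n"
    using assms by (simp add: q_def algebra_simps)
  have L: "real L \<le> C * real q"
    using F(2) by (simp add: L_def)
  have kL: "real k * real L \<le> 2 * C * real n"
  proof -
    have "real k * real L \<le> real k * (C * real q)"
      using L by (intro mult_left_mono) auto
    also have "\<dots> = C * (real k * real q)" by simp
    also have "\<dots> \<le> C * (2 * real n)"
      using kq F(2) by (intro mult_left_mono)
    finally show ?thesis by simp
  qed
  have p: "real p \<le> 2 * (1 + C) / real k * real n"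
  proof -
    have "real k * real p \<le> 2 * (1 + C) * real n"
      using kq kL by (simp add: p_def algebra_simps)
    then show ?thesis using assms by (simp add: field_simps)
  qed
  have "\<exists>m. real m \<le> ?b \<and> filling S ?R m (free_word w) []"
    if w: "w \<in> relations G S" "length w \<le> n" for w
  proof -
    have "n \<le> k * q"
      using dividend_less_times_div[of k n] assms by (simp add: q_def)
    with w obtain ws where ws: "concat ws = w" "length ws = k" "\<And>v. v \<in> set ws \<Longrightarrow> length v \<le> q"
      using concat_pieces[of w k q] by auto
    have wsS: "v \<in> lists S" if "v \<in> set ws" for v
      using w ws(1) that by (auto simp: relations_def)
    obtain h where h: "\<And>w. w \<in> lists S \<Longrightarrow> h w \<in> F \<and> word_value G (h w) = word_value G w \<and>
        real (length (h w)) \<le> C * real (length w)"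
      using F(3) by metis
    have hL: "length (h v) \<le> L" if "v \<in> set ws" for v
    proof -
      have "real (length (h v)) \<le> C * real (length v)"
        using h wsS that by blast
      also have "\<dots> \<le> C * real q"
        using F(2) ws(3)[OF that] by (intro mult_left_mono) auto
      finally show ?thesis by (simp add: L_def le_nat_iff le_floor_iff)
    qed
    have "filling S ?R (f p + f 2 * L) (free_word v) (free_word (h v))" if "v \<in> set ws" for v
    proof (rule filling_mono)
      have "dehn G S l (length v + length (h v)) \<le> enat (f p)"
        unfolding fin[symmetric] p_def using ws(3) hL that by (intro dehn_mono add_mono)
      then show "filling S ?R (f p + f 2 * length (h v)) (free_word v) (free_word (h v))"
        using h wsS that F(1) by (intro filling_equivalent_words S) (auto simp: fin)
      show "f p + f 2 * length (h v) \<le> f p + f 2 * L"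
        using hL[OF that] by simp
    qed
    then have fill: "filling S ?R (k * (f p + f 2 * L)) (free_word w) (free_word (concat (map h ws)))"
      using filling_concat[of ws S ?R "f p + f 2 * L" h] wsS ws by simp
    have one: "word_value G (concat (map h ws)) = \<one>"
      using word_value_concat_cong[OF S(1), of ws h] h wsS F(1) w ws(1) by (auto simp: relations_def)
    have "concat (map h ws) \<in> lists S"
      using h wsS F(1) by fastforce
    with one have rel: "concat (map h ws) \<in> relations G S"
      by (simp add: relations_def)
    have inF: "concat (map h ws) \<in> concat_upto F k"
      using h wsS ws(2) unfolding concat_upto_def by (intro CollectI exI[of _ "map h ws"]) auto
    have len: "length (concat (map h ws)) \<le> k * L"
    proof -
      have "sum_list (map (length \<circ> h) ws) \<le> sum_list (map (\<lambda>_. L) ws)"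
        using hL by (intro sum_list_mono) auto
      then show ?thesis using ws(2) by (simp add: length_concat sum_list_triv)
    qed
    obtain m where m: "real m \<le> a * real (k * L) powr \<zeta>"
      "filling S ?R m (free_word (concat (map h ws))) []"
      by (rule restricted_dehn_filling[OF a inF rel len])
    then show ?thesis
      using filling_trans[OF fill m(2)] m(1)
      by (intro exI[of _ "k * (f p + f 2 * L) + m"] conjI) simp_all
  qed
  then have "dehn G S l n \<le> enat (nat \<lfloor>?b\<rfloor>)"
    unfolding dehn_le_iff by (blast intro: filling_mono le_nat_floor)
  moreover have "?b \<ge> 0"
  proof -
    have "0 \<le> ereal_of_enat (restricted_dehn G S l (concat_upto F k) (k * L))" by simp
    then have "0 \<le> ereal (a * real (k * L) powr \<zeta>)"
      using a order_trans by blast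
    then show ?thesis by simp
  qed
  ultimately have "real (f n) \<le> ?b"
    unfolding fin enat_ord_simps by (metis le_nat_iff le_floor_iff of_int_of_nat_eq zero_le_floor)
  also have "\<dots> = real k * real (f p) + real (f 2) * (real k * real L)
      + a * (real k * real L) powr \<zeta>"
    by (simp add: algebra_simps)
  also have "\<dots> \<le> real k * real (f p) + real (f 2) * (2 * C * real n powr \<zeta>)
      + \<bar>a\<bar> * ((2 * C) powr \<zeta> * real n powr \<zeta>)"
  proof -
    have "real n powr 1 \<le> real n powr \<zeta>"
      using assms by (intro powr_mono) auto
    then have "2 * C * real n \<le> 2 * C * real n powr \<zeta>"
      using F(2) by (intro mult_left_mono) auto
    then have "real (f 2) * (real k * real L) \<le> real (f 2) * (2 * C * real n powr \<zeta>)"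
      using kL by (intro mult_left_mono) auto
    moreover have "(real k * real L) powr \<zeta> \<le> (2 * C * real n) powr \<zeta>"
      using kL assms by (intro powr_mono2) auto
    then have "a * (real k * real L) powr \<zeta> \<le> \<bar>a\<bar> * (2 * C * real n) powr \<zeta>"
      by (intro mult_mono) auto
    moreover have "(2 * C * real n) powr \<zeta> = (2 * C) powr \<zeta> * real n powr \<zeta>"
      by (rule powr_mult)
    ultimately show ?thesis by simp
  qed
  finally have "real (f n) \<le> real k * real (f p)
      + (2 * C * real (f 2) + \<bar>a\<bar> * (2 * C) powr \<zeta>) * real n powr \<zeta>"
    by (simp add: algebra_simps)
  with p show ?thesis by blast
qed

lemma powr_bound_from_recursion:
  fixes f :: "nat \<Rightarrow> real" and r A \<zeta> :: real
  assumes "f 0 \<le> 0" "\<zeta> > 0" "k \<ge> 1" "r \<ge> 0" "real k * r powr \<zeta> \<le> 1/2" "A \<ge> 0"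
    and rec: "\<And>n. n \<ge> N \<Longrightarrow> \<exists>p. real p \<le> r * real n \<and> f n \<le> real k * f p + A * real n powr \<zeta>"
  shows "\<exists>K. \<forall>n. f n \<le> K * real n powr \<zeta>"
proof -
  define K where "K = 2 * A + (\<Sum>n\<le>N. \<bar>f n\<bar>)"
  have K: "K \<ge> 0" "2 * A \<le> K"
    using assms by (auto simp: K_def intro!: add_nonneg_nonneg sum_nonneg)
  have "r < 1"
  proof (rule ccontr)
    assume "\<not> r < 1"
    then have "1 \<le> r powr \<zeta>" using assms by (simp add: ge_one_powr_ge_zero)
    then have "1 * 1 \<le> real k * r powr \<zeta>"
      using assms by (intro mult_mono) auto
    with assms show False by simp
  qed
  have "f n \<le> K * real n powr \<zeta>" for n
  proof (induction n rule: less_induct)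
    case (less n)
    consider "n = 0" | "1 \<le> n" "n < N" | "1 \<le> n" "N \<le> n" by linarith
    then show ?case
    proof cases
      case 1
      with assms show ?thesis by simp
    next
      case 2
      then have "\<bar>f n\<bar> \<le> (\<Sum>n\<le>N. \<bar>f n\<bar>)"
        by (intro member_le_sum) auto
      then have "f n \<le> K * 1" using assms by (simp add: K_def)
      also have "\<dots> \<le> K * real n powr \<zeta>"
        using 2 K assms by (intro mult_left_mono ge_one_powr_ge_zero) auto
      finally show ?thesis .
    next
      case 3
      obtain p where p: "real p \<le> r * real n" "f n \<le> real k * f p + A * real n powr \<zeta>"
        using rec 3 by blast
      have "r * real n < 1 * real n"
        using \<open>r < 1\<close> 3 by (intro mult_strict_right_mono) auto
      then have "p < n" using p(1) by simp
      have "f p \<le> K * real p powr \<zeta>" using less \<open>p < n\<close> .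
      also have "\<dots> \<le> K * (r * real n) powr \<zeta>"
        using p K assms by (intro mult_left_mono powr_mono2) auto
      finally have "real k * f p \<le> real k * (K * (r * real n) powr \<zeta>)"
        by (rule mult_left_mono) simp
      also have "\<dots> = (real k * r powr \<zeta>) * (K * real n powr \<zeta>)"
        using assms by (simp add: powr_mult)
      also have "\<dots> \<le> 1/2 * (K * real n powr \<zeta>)"
        using assms K by (intro mult_right_mono) auto
      finally have "f n \<le> 1/2 * (K * real n powr \<zeta>) + A * real n powr \<zeta>"
        using p(2) by linarith
      also have "A * real n powr \<zeta> \<le> K / 2 * real n powr \<zeta>"
        using K by (intro mult_right_mono) auto
      finally show ?thesis by simp
    qed
  qed
  then show ?thesis by blast
qed

lemma exists_contracting_subdivision:
  fixes c \<zeta> :: real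
  assumes "\<zeta> > 1" "c \<ge> 0"
  obtains k :: nat where "k \<ge> 1" "real k * (c / real k) powr \<zeta> \<le> 1/2"
proof -
  have "((\<lambda>k. c powr \<zeta> * real k powr (1 - \<zeta>)) \<longlongrightarrow> c powr \<zeta> * 0) sequentially"
    using assms by (intro tendsto_mult tendsto_const tendsto_neg_powr filterlim_real_sequentially) auto
  then have "eventually (\<lambda>k. c powr \<zeta> * real k powr (1 - \<zeta>) < 1/2) sequentially"
    by (rule order_tendstoD) simp
  then have "eventually (\<lambda>k. k \<ge> 1 \<and> c powr \<zeta> * real k powr (1 - \<zeta>) < 1/2) sequentially"
    using eventually_ge_at_top[of 1] by eventually_elim simp
  then obtain k :: nat where k: "k \<ge> 1" "c powr \<zeta> * real k powr (1 - \<zeta>) < 1/2"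
    using eventually_happens' sequentially_bot by blast
  moreover have "real k * (c / real k) powr \<zeta> = c powr \<zeta> * real k powr (1 - \<zeta>)"
    using k(1) assms by (simp add: powr_divide powr_diff)
  ultimately show ?thesis using that by simp
qed

theorem proposition4p3:
  fixes G :: "('a, 'b) monoid_scheme" and T :: "'a topology" and S :: "'a set"
    and l :: nat and F :: "'a list set" and \<zeta> :: real
  assumes "locally_compact_group G T"
    and "compact_symmetric_generating_set G T S"
    and "presented_in_length G S l"
    and dehn_finite: "\<And>n. dehn G S l n < \<infinity>"
    and "efficient G S F"
    and "\<zeta> > 1"
    and "\<And>k::nat. k \<ge> 1 \<Longrightarrow>
           \<exists>a::real. \<forall>n. ereal_of_enat (restricted_dehn G S l (concat_upto F k) n)
                           \<le> ereal (a * real n powr \<zeta>)"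
  shows "\<exists>C'::real. \<forall>n. ereal_of_enat (dehn G S l n) \<le> ereal (C' * real n powr \<zeta>)"
proof -
  interpret group G using assms(1) by (simp add: locally_compact_group_def)
  have S: "S \<subseteq> carrier G" "\<forall>s\<in>S. inv\<^bsub>G\<^esub> s \<in> S"
    using assms(1,2) compactin_subset_topspace
    by (fastforce simp: locally_compact_group_def compact_symmetric_generating_set_def)+
  define f where "f n = the_enat (dehn G S l n)" for n
  have f: "dehn G S l n = enat (f n)" for n
    using dehn_finite[of n] by (auto simp: f_def)
  obtain C0 :: real where C0: "F \<subseteq> lists S" "\<forall>w \<in> lists S. \<exists>w' \<in> F.
      word_value G w' = word_value G w \<and> real (length w') \<le> C0 * real (length w)"
    using assms(5) by (auto simp: efficient_def)
  define C where "C = max C0 0"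
  have "C \<ge> 0" by (simp add: C_def)
  have C: "\<exists>w'\<in>F. word_value G w' = word_value G w \<and> real (length w') \<le> C * real (length w)"
    if "w \<in> lists S" for w
  proof -
    have "C0 * real (length w) \<le> C * real (length w)"
      by (intro mult_right_mono) (auto simp: C_def)
    then show ?thesis using C0(2) that by (meson order_trans)
  qed
  obtain k :: nat where k: "k \<ge> 1" "real k * (2 * (1 + C) / real k) powr \<zeta> \<le> 1/2"
    using exists_contracting_subdivision[OF assms(6), of "2 * (1 + C)"] \<open>C \<ge> 0\<close> by auto
  obtain a :: real where a: "\<And>n. ereal_of_enat (restricted_dehn G S l (concat_upto F k) n)
      \<le> ereal (a * real n powr \<zeta>)"
    using assms(7)[OF k(1)] by blast
  have "\<exists>K. \<forall>n. real (f n) \<le> K * real n powr \<zeta>"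
  proof (rule powr_bound_from_recursion[OF _ _ k(1) _ k(2)])
    show "real (f 0) \<le> 0" by (simp add: f_def dehn_zero zero_enat_def)
    show "0 \<le> 2 * C * real (f 2) + \<bar>a\<bar> * (2 * C) powr \<zeta>"
      using \<open>C \<ge> 0\<close> by simp
    show "\<exists>p. real p \<le> 2 * (1 + C) / real k * real n \<and> real (f n) \<le> real k * real (f p)
        + (2 * C * real (f 2) + \<bar>a\<bar> * (2 * C) powr \<zeta>) * real n powr \<zeta>" if "k \<le> n" for n
      using dehn_recursion[OF S f C0(1) \<open>C \<ge> 0\<close> C a _ k(1) that] assms(6) by simp
  qed (use assms(6) \<open>C \<ge> 0\<close> in auto)
  then show ?thesis by (simp add: f)
qed

end
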